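(* Let $(X,d)$ be a metric space, let $\kappa$ be an $e^{0}$-distance on $X$, and let $\mathcal{D}_{\kappa}:\mathcal{CB}(X)\times\mathcal{CB}(X)\to[0,+\infty)$ be the $e^{0}$-metric on $\mathcal{CB}(X)$ induced by $\kappa$, i.e. $\mathcal{D}_{\kappa}(A,B)=\max\{\xi_{\kappa}(A,B),\xi_{\kappa}(B,A)\}$ with $\xi_{\kappa}(A,B)=\sup_{x\in A}\kappa(x,B)$. Then for all $A,B,C\in\mathcal{CB}(X)$ the following hold: (i) $\xi_{\kappa}(A,B)=0$ if and only if $A\subseteq B$; (ii) $\xi_{\kappa}(A,B)\leq\xi_{\kappa}(A,C)+\xi_{\kappa}(C,B)$; (iii) every $e^{0}$-metric $\mathcal{D}_{\kappa}$ is a metric on $\mathcal{CB}(X)$.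
   Context: For a metric space $(X,d)$, $\mathcal{CB}(X)$ denotes the family of all nonempty closed and bounded subsets of $X$ (with respect to $d$). A function $\kappa:X\times X\to[0,+\infty)$ is an $e$-distance (essential distance) on $(X,d)$ if: ($\tau1$) $\kappa(x,z)\leq\kappa(x,y)+\kappa(y,z)$ for all $x,y,z\in X$; ($\tau2$) if $x\in X$ and $\{y_n\}$ is a sequence in $X$ with $\lim_{n\to\infty}y_n=y$ such that $\kappa(x,y_n)\leq M$ for all $n$, for some $M=M(x)>0$, then $\kappa(x,y)\leq M$; ($\tau3$) for any sequence $\{x_n\}$ in $X$ with $\lim_{n\to\infty}\sup\{\kappa(x_n,x_m):m>n\}=0$, if there exists a sequence $\{y_n\}$ in $X$ such that $\lim_{n\to\infty}\kappa(x_n,y_n)=0$, then $\lim_{n\to\infty}d(x_n,y_n)=0$. Limits of sequences in $X$ are with respect to $d$; $\kappa$ is not assumed symmetric. An $e^{0}$-distance is an $e$-distance $\kappa$ with $\kappa(x,x)=0$ for all $x\in X$. For $x\in X$ and nonempty $C\subseteq X$, $\kappa(x,C)=\inf_{y\in C}\kappa(x,y)$. The function $\mathcal{D}_{\kappa}:\mathcal{CB}(X)\times\mathcal{CB}(X)\to[0,+\infty)$ (with values in $[0,+\infty)$ as part of its definition) given by $\mathcal{D}_{\kappa}(A,B)=\max\{\xi_{\kappa}(A,B),\xi_{\kappa}(B,A)\}$, where $\xi_{\kappa}(A,B)=\sup_{x\in A}\kappa(x,B)$, is called the $e^{0}$-metric on $\mathcal{CB}(X)$ induced by $\kappa$. 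*)

theory Defs
  imports "HOL-Analysis.Analysis"
begin

definition CB :: "'a::metric_space set set" where
  "CB = {A. A \<noteq> {} \<and> closed A \<and> bounded A}"

text \<open>
  The supremum in the third axiom is taken in \<^typ>\<open>ennreal\<close>, because the set
  of values need not be bounded; the real supremum would then be a junk value.
  Nonnegativity of \<^term>\<open>\<kappa>\<close> makes the embedding \<^const>\<open>ennreal\<close> faithful.
\<close>

definition e_distance :: "('a::metric_space \<Rightarrow> 'a \<Rightarrow> real) \<Rightarrow> bool" where
  "e_distance \<kappa> \<longleftrightarrow>
     (\<forall>x y. 0 \<le> \<kappa> x y) \<and>
     (\<forall>x y z. \<kappa> x z \<le> \<kappa> x y + \<kappa> y z) \<and>
     (\<forall>x (ys :: nat \<Rightarrow> 'a) y M.
        M > 0 \<longrightarrow> ys \<longlonglongrightarrow> y \<longrightarrow> (\<forall>n. \<kappa> x (ys n) \<le> M) \<longrightarrow> \<kappa> x y \<le> M) \<and>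
     (\<forall>xs ys :: nat \<Rightarrow> 'a.
        (\<lambda>n. SUP m\<in>{n<..}. ennreal (\<kappa> (xs n) (xs m))) \<longlonglongrightarrow> 0 \<longrightarrow>
        (\<lambda>n. \<kappa> (xs n) (ys n)) \<longlonglongrightarrow> 0 \<longrightarrow>
        (\<lambda>n. dist (xs n) (ys n)) \<longlonglongrightarrow> 0)"

definition e0_distance :: "('a::metric_space \<Rightarrow> 'a \<Rightarrow> real) \<Rightarrow> bool" where
  "e0_distance \<kappa> \<longleftrightarrow> e_distance \<kappa> \<and> (\<forall>x. \<kappa> x x = 0)"

text \<open>Only meant for nonempty \<^term>\<open>C\<close>.\<close>

definition kappa_set :: "('a \<Rightarrow> 'a \<Rightarrow> real) \<Rightarrow> 'a \<Rightarrow> 'a set \<Rightarrow> real" where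
  "kappa_set \<kappa> x C = (INF y\<in>C. \<kappa> x y)"

text \<open>
  A general e-distance may be unbounded on bounded sets, so the following two
  quantities take values in \<^typ>\<open>ennreal\<close>. That the induced e0-metric has values in
  the nonnegative reals on \<^const>\<open>CB\<close> is a property of \<^term>\<open>\<kappa>\<close>, expressed by
  finiteness of \<open>e0_metric\<close> there.
\<close>

definition xi :: "('a \<Rightarrow> 'a \<Rightarrow> real) \<Rightarrow> 'a set \<Rightarrow> 'a set \<Rightarrow> ennreal" where
  "xi \<kappa> A B = (SUP x\<in>A. ennreal (kappa_set \<kappa> x B))"

definition e0_metric :: "('a \<Rightarrow> 'a \<Rightarrow> real) \<Rightarrow> 'a set \<Rightarrow> 'a set \<Rightarrow> ennreal" where
  "e0_metric \<kappa> A B = max (xi \<kappa> A B) (xi \<kappa> B A)"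

end

theory Submission
  imports Defs
begin

text \<open>
  The excess \<open>xi \<kappa> A B\<close> measures how far \<open>A\<close> sticks out of \<open>B\<close>, as in the construction of
  the Hausdorff metric, and the proof follows that construction. The triangle inequality for
  \<open>\<kappa>\<close> passes to point-to-set distances, \<open>\<kappa>(x,B) \<le> \<kappa>(x,z) + \<kappa>(z,B)\<close>, and from there, by an
  infimum over \<open>z \<in> C\<close> and a supremum over \<open>x \<in> A\<close>, to \<open>xi\<close> (lemma \<open>xi_triangle\<close>).

  The link between \<open>\<kappa>\<close> and the topology of the space is the equivalence of \<open>\<kappa>(x,B) = 0\<close> and
  \<open>x \<in> B\<close> for closed \<open>B\<close> (lemma \<open>kappa_set_eq_0_iff\<close>). If the infimum vanishes, some sequence
  \<open>y\<^sub>n\<close> in \<open>B\<close> satisfies \<open>\<kappa>(x,y\<^sub>n) \<longlonglongrightarrow> 0\<close>. The constant sequence \<open>x\<close> satisfies the Cauchy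
  condition of the third axiom because \<open>\<kappa>(x,x) = 0\<close>, so that axiom turns
  \<open>\<kappa>(x,y\<^sub>n) \<longlonglongrightarrow> 0\<close> into \<open>y\<^sub>n \<longlonglongrightarrow> x\<close> in the original metric, and closedness puts \<open>x\<close> in
  \<open>B\<close>. Hence \<open>xi \<kappa> A B = 0\<close> means \<open>A \<subseteq> B\<close>, and the symmetrization \<open>e0_metric\<close> vanishes exactly
  when \<open>A = B\<close>.
\<close>

lemma kappa_set_nonneg:
  assumes "\<And>x y. 0 \<le> \<kappa> x y" and "B \<noteq> {}"
  shows "0 \<le> kappa_set \<kappa> x B"
  unfolding kappa_set_def using assms by (intro cINF_greatest) auto

lemma kappa_set_le:
  assumes "\<And>x y. 0 \<le> \<kappa> x y" and "y \<in> B"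
  shows "kappa_set \<kappa> x B \<le> \<kappa> x y"
  unfolding kappa_set_def using assms by (intro cINF_lower bdd_belowI2[where m = 0]) auto

lemma kappa_set_triangle:
  assumes nonneg: "\<And>x y. 0 \<le> \<kappa> x y"
    and triangle: "\<And>x y z. \<kappa> x z \<le> \<kappa> x y + \<kappa> y z"
    and "B \<noteq> {}"
  shows "kappa_set \<kappa> x B \<le> \<kappa> x z + kappa_set \<kappa> z B"
proof -
  have "kappa_set \<kappa> x B - \<kappa> x z \<le> \<kappa> z y" if "y \<in> B" for y
    using kappa_set_le[of \<kappa> y B x, OF nonneg that] triangle[of x y z] by linarith
  then have "kappa_set \<kappa> x B - \<kappa> x z \<le> kappa_set \<kappa> z B"
    unfolding kappa_set_def[of \<kappa> z B] using \<open>B \<noteq> {}\<close> by (intro cINF_greatest) auto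
  then show ?thesis by linarith
qed

lemma xi_triangle:
  assumes nonneg: "\<And>x y. 0 \<le> \<kappa> x y"
    and triangle: "\<And>x y z. \<kappa> x z \<le> \<kappa> x y + \<kappa> y z"
    and "B \<noteq> {}" and "C \<noteq> {}"
  shows "xi \<kappa> A B \<le> xi \<kappa> A C + xi \<kappa> C B"
proof (cases "xi \<kappa> C B" rule: ennreal_cases)
  \<comment> \<open>A finite excess is a real number \<open>r\<close> that can be subtracted, so that the infimum over \<open>C\<close>
    is taken in the reals.\<close>
  case (real r)
  have "ennreal (kappa_set \<kappa> x B) \<le> xi \<kappa> A C + xi \<kappa> C B" if "x \<in> A" for x
  proof -
    have "kappa_set \<kappa> x B - r \<le> \<kappa> x z" if "z \<in> C" for z
    proof -
      have "ennreal (kappa_set \<kappa> z B) \<le> ennreal r"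
        unfolding real(2)[symmetric] xi_def using that by (rule SUP_upper)
      then have "kappa_set \<kappa> z B \<le> r"
        using real(1) by (simp add: ennreal_le_iff)
      then show ?thesis
        using kappa_set_triangle[of \<kappa> B x z, OF nonneg triangle \<open>B \<noteq> {}\<close>] by linarith
    qed
    then have "kappa_set \<kappa> x B - r \<le> kappa_set \<kappa> x C"
      unfolding kappa_set_def[of \<kappa> x C] using \<open>C \<noteq> {}\<close> by (intro cINF_greatest) auto
    then have "ennreal (kappa_set \<kappa> x B) \<le> ennreal (kappa_set \<kappa> x C + r)"
      by (intro ennreal_leI) simp
    also have "\<dots> = ennreal (kappa_set \<kappa> x C) + ennreal r"
      using kappa_set_nonneg[of \<kappa> C x, OF nonneg \<open>C \<noteq> {}\<close>] real(1) by (rule ennreal_plus)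
    also have "\<dots> \<le> xi \<kappa> A C + xi \<kappa> C B"
      unfolding real(2) unfolding xi_def using \<open>x \<in> A\<close> by (intro add_right_mono SUP_upper)
    finally show ?thesis .
  qed
  then show ?thesis
    unfolding xi_def[of \<kappa> A B] by (rule SUP_least)
qed simp

text \<open>
  Vanishing of the infimum gives a \<open>\<kappa>\<close>-minimizing sequence in \<open>B\<close>; compared with the constant
  sequence \<open>x\<close> in the third axiom of an e-distance, it converges to \<open>x\<close> in the metric.
\<close>

lemma kappa_set_eq_0_iff:
  fixes \<kappa> :: "'a::metric_space \<Rightarrow> 'a \<Rightarrow> real"
  assumes "e0_distance \<kappa>" and "closed B" and "B \<noteq> {}"
  shows "kappa_set \<kappa> x B = 0 \<longleftrightarrow> x \<in> B"
proof
  have nonneg: "\<And>x y. 0 \<le> \<kappa> x y" and refl: "\<And>x. \<kappa> x x = 0"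
    and tau3: "\<And>xs ys :: nat \<Rightarrow> 'a.
        (\<lambda>n. SUP m\<in>{n<..}. ennreal (\<kappa> (xs n) (xs m))) \<longlonglongrightarrow> 0 \<Longrightarrow>
        (\<lambda>n. \<kappa> (xs n) (ys n)) \<longlonglongrightarrow> 0 \<Longrightarrow> (\<lambda>n. dist (xs n) (ys n)) \<longlonglongrightarrow> 0"
    using assms(1) unfolding e0_distance_def e_distance_def by blast+
  {
    assume "x \<in> B"
    then show "kappa_set \<kappa> x B = 0"
      using kappa_set_le[of \<kappa> x B x, OF nonneg] kappa_set_nonneg[of \<kappa> B x, OF nonneg \<open>B \<noteq> {}\<close>]
      by (simp add: refl)
  next
    assume zero: "kappa_set \<kappa> x B = 0"
    have "\<exists>y\<in>B. \<kappa> x y < inverse (real (Suc n))" for n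
    proof -
      have "(INF y\<in>B. \<kappa> x y) < inverse (real (Suc n))"
        using zero unfolding kappa_set_def by simp
      then show ?thesis
        using \<open>B \<noteq> {}\<close> nonneg by (subst (asm) cINF_less_iff) (auto intro: bdd_belowI2[where m = 0])
    qed
    then obtain ys where in_B: "\<And>n. ys n \<in> B"
      and small: "\<And>n. \<kappa> x (ys n) < inverse (real (Suc n))"
      by metis
    have "(\<lambda>n. \<kappa> x (ys n)) \<longlonglongrightarrow> 0"
      by (rule tendsto_sandwich[OF _ _ tendsto_const LIMSEQ_inverse_real_of_nat])
        (use nonneg less_imp_le[OF small] in \<open>auto intro: always_eventually simp del: of_nat_Suc\<close>)
    then have "(\<lambda>n. dist x (ys n)) \<longlonglongrightarrow> 0"
      by (intro tau3[of "\<lambda>_. x"]) (simp_all add: refl)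
    then have "ys \<longlonglongrightarrow> x"
      by (subst tendsto_dist_iff) (simp add: dist_commute)
    then show "x \<in> B"
      using closed_sequentially[OF \<open>closed B\<close>] in_B by blast
  }
qed

lemma xi_eq_0_iff:
  assumes "e0_distance \<kappa>" and "closed B" and "B \<noteq> {}"
  shows "xi \<kappa> A B = 0 \<longleftrightarrow> A \<subseteq> B"
proof -
  have nonneg: "\<And>x y. 0 \<le> \<kappa> x y"
    using assms(1) unfolding e0_distance_def e_distance_def by blast
  have "xi \<kappa> A B = 0 \<longleftrightarrow> (\<forall>x\<in>A. ennreal (kappa_set \<kappa> x B) = 0)"
    unfolding xi_def bot_ennreal[symmetric] by (rule SUP_bot_conv)
  also have "\<dots> \<longleftrightarrow> (\<forall>x\<in>A. kappa_set \<kappa> x B = 0)"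
    using kappa_set_nonneg[of \<kappa> B, OF nonneg \<open>B \<noteq> {}\<close>] by (simp add: ennreal_eq_zero_iff)
  finally show ?thesis
    using kappa_set_eq_0_iff[OF assms] by blast
qed

lemma e0_metric_triangle:
  assumes "\<And>x y. 0 \<le> \<kappa> x y"
    and "\<And>x y z. \<kappa> x z \<le> \<kappa> x y + \<kappa> y z"
    and "A \<noteq> {}" and "B \<noteq> {}" and "C \<noteq> {}"
  shows "e0_metric \<kappa> A B \<le> e0_metric \<kappa> A C + e0_metric \<kappa> C B"
proof -
  have "xi \<kappa> A B \<le> e0_metric \<kappa> A C + e0_metric \<kappa> C B"
    using xi_triangle[of \<kappa> B C A] assms unfolding e0_metric_def
    by (meson add_mono max.cobounded1 order_trans)
  moreover have "xi \<kappa> B A \<le> e0_metric \<kappa> C B + e0_metric \<kappa> A C"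
    using xi_triangle[of \<kappa> A C B] assms unfolding e0_metric_def
    by (meson add_mono max.cobounded2 order_trans)
  ultimately show ?thesis
    unfolding e0_metric_def[of \<kappa> A B] by (simp add: add.commute)
qed

theorem theorem1p3:
  fixes \<kappa> :: "'a::metric_space \<Rightarrow> 'a \<Rightarrow> real"
  assumes "e0_distance \<kappa>"
    and "\<forall>A\<in>CB. \<forall>B\<in>CB. e0_metric \<kappa> A B < \<infinity>"
  shows "(\<forall>A\<in>CB. \<forall>B\<in>CB. xi \<kappa> A B = 0 \<longleftrightarrow> A \<subseteq> B) \<and>
         (\<forall>A\<in>CB. \<forall>B\<in>CB. \<forall>C\<in>CB. xi \<kappa> A B \<le> xi \<kappa> A C + xi \<kappa> C B) \<and>
         Metric_space CB (\<lambda>A B. enn2real (e0_metric \<kappa> A B))"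
proof (intro conjI)
  have nonneg: "\<And>x y. 0 \<le> \<kappa> x y" and triangle: "\<And>x y z. \<kappa> x z \<le> \<kappa> x y + \<kappa> y z"
    using assms(1) unfolding e0_distance_def e_distance_def by blast+
  have fin: "e0_metric \<kappa> A B < top" if "A \<in> CB" "B \<in> CB" for A B
    using assms(2) that by simp
  show zero: "\<forall>A\<in>CB. \<forall>B\<in>CB. xi \<kappa> A B = 0 \<longleftrightarrow> A \<subseteq> B"
    using xi_eq_0_iff[OF assms(1)] unfolding CB_def by blast
  show "\<forall>A\<in>CB. \<forall>B\<in>CB. \<forall>C\<in>CB. xi \<kappa> A B \<le> xi \<kappa> A C + xi \<kappa> C B"
    using xi_triangle[of \<kappa>, OF nonneg triangle] unfolding CB_def by blast
  show "Metric_space CB (\<lambda>A B. enn2real (e0_metric \<kappa> A B))"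
  proof
    show "0 \<le> enn2real (e0_metric \<kappa> A B)" for A B
      by simp
    show "enn2real (e0_metric \<kappa> A B) = enn2real (e0_metric \<kappa> B A)" for A B
      by (simp add: e0_metric_def max.commute)
  next
    fix A B :: "'a set" assume AB: "A \<in> CB" "B \<in> CB"
    have "enn2real (e0_metric \<kappa> A B) = 0 \<longleftrightarrow> e0_metric \<kappa> A B = 0"
      using fin[OF AB] by (auto simp: enn2real_eq_0_iff)
    also have "\<dots> \<longleftrightarrow> xi \<kappa> A B = 0 \<and> xi \<kappa> B A = 0"
      unfolding e0_metric_def by (metis max.cobounded1 max.cobounded2 max.idem le_zero_eq)
    also have "\<dots> \<longleftrightarrow> A = B"
      using zero AB by blast
    finally show "enn2real (e0_metric \<kappa> A B) = 0 \<longleftrightarrow> A = B" .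
  next
    fix A B C :: "'a set" assume ABC: "A \<in> CB" "B \<in> CB" "C \<in> CB"
    have "e0_metric \<kappa> A C \<le> e0_metric \<kappa> A B + e0_metric \<kappa> B C"
      using e0_metric_triangle[of \<kappa> A C B, OF nonneg triangle] ABC unfolding CB_def by blast
    then have "enn2real (e0_metric \<kappa> A C) \<le> enn2real (e0_metric \<kappa> A B + e0_metric \<kappa> B C)"
      using fin ABC by (intro enn2real_mono) auto
    also have "\<dots> = enn2real (e0_metric \<kappa> A B) + enn2real (e0_metric \<kappa> B C)"
      using fin ABC by (intro enn2real_plus)
    finally show "enn2real (e0_metric \<kappa> A C) \<le>
      enn2real (e0_metric \<kappa> A B) + enn2real (e0_metric \<kappa> B C)" .
  qed
qed

end
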